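(* Let $k=2a\geq 4$ be an even integer and let $m$ be an integer with $k\leq m^2/2$ and $m\geq a$. Let $\Delta=C_k$ be the cycle of length $k$ in $\mathbf{K}_{m,m}$ with edges $\{R_i,C_i\}$ for $1\leq i\leq a$, $\{R_{i+1},C_i\}$ for $1\leq i\leq a-1$, and $\{R_1,C_a\}$. Let $K$, $G$, $\mathcal{D}(\Delta)$, $\widehat{\mathcal{D}}(\Delta)$ be as defined in the context. Then $\mathcal{D}(\Delta)=\widehat{\mathcal{D}}(\Delta)=\mathcal{D}$, say, is a $1$-design, and the groups $K$ and $G$ are both flag-transitive on $\mathcal{D}$. Moreover, $\mathcal{D}$ is never a $3$-design, and $\mathcal{D}$ is a $2$-design if and only if $m=k-2$, in which case $\mathcal{D}$ is a $2$-$((k-2)^2,k,\lambda)$ design with $$\lambda=\frac{(k-3)!\,(k-4)!}{\left(\left(\frac{k}{2}-2\right)!\right)^2}.$$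
   Context: Let $\mathcal{R}=\{R_1,\dots,R_m\}$ and $\mathcal{C}=\{C_1,\dots,C_m\}$ be disjoint sets of size $m$, let $\mathcal{P}=\mathcal{R}\times\mathcal{C}$, and let $\mathbf{K}_{m,m}$ be the complete bipartite graph with vertex set $\mathcal{R}\cup\mathcal{C}$ and edges all pairs $\{R,C\}$ with $R\in\mathcal{R}$, $C\in\mathcal{C}$. Subgraphs $\Delta$ of $\mathbf{K}_{m,m}$ are identified with their edge sets. For a subgraph $\Delta$ put $B(\Delta)=\{(R,C)\in\mathcal{P} : \{R,C\}\text{ is an edge of }\Delta\}$. Let $K=\mathrm{Sym}(\mathcal{R})\times\mathrm{Sym}(\mathcal{C})$ act on $\mathbf{K}_{m,m}$ and on $\mathcal{P}$ in the natural way; let $\tau$ be the automorphism of $\mathbf{K}_{m,m}$ interchanging $R_i$ and $C_i$ for each $i$, which acts on $\mathcal{P}$ by $(R_i,C_j)\mapsto(R_j,C_i)$; and let $G=\langle K,\tau\rangle\cong \mathrm{S}_m\wr\mathrm{S}_2$. Define the incidence structures $\mathcal{D}(\Delta)=(\mathcal{P},\{B(\Delta^g) : g\in K\})$ and $\widehat{\mathcal{D}}(\Delta)=(\mathcal{P},\{B(\Delta^g) : g\in G\})$, with incidence being inclusion. An incidence structure with point set $\mathcal{P}$ and blocks that are subsets of $\mathcal{P}$ is a $t$-$(v,k,\lambda)$ design ($t,v,k,\lambda$ positive integers) if $|\mathcal{P}|=v$, every block has size $k$, and every $t$-subset of $\mathcal{P}$ lies in exactly $\lambda$ blocks; it is a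 $t$-design if this holds for some $v,k,\lambda$. A flag is an incident point-block pair, and a group of automorphisms is flag-transitive if it is transitive on the set of flags. *)

theory Defs
  imports Complex_Main "HOL-Algebra.Group_Action" "HOL-Algebra.Generated_Groups"
begin

text \<open>An incidence structure is a pair of a point set and a set of blocks, each block being
  a set of points; incidence is inclusion.\<close>

type_synonym 'p incidence_structure = "'p set \<times> 'p set set"

abbreviation points :: "'p incidence_structure \<Rightarrow> 'p set" where
  "points \<equiv> fst"

abbreviation blocks :: "'p incidence_structure \<Rightarrow> 'p set set" where
  "blocks \<equiv> snd"

definition is_design ::
  "nat \<Rightarrow> nat \<Rightarrow> nat \<Rightarrow> nat \<Rightarrow> 'p incidence_structure \<Rightarrow> bool" where
  "is_design t v k l D \<longleftrightarrow>
     t > 0 \<and> v > 0 \<and> k > 0 \<and> l > 0 \<and>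
     finite (points D) \<and> card (points D) = v \<and>
     (\<forall>B\<in>blocks D. B \<subseteq> points D \<and> card B = k) \<and>
     (\<forall>T. T \<subseteq> points D \<and> card T = t \<longrightarrow> card {B \<in> blocks D. T \<subseteq> B} = l)"

definition is_t_design :: "nat \<Rightarrow> 'p incidence_structure \<Rightarrow> bool" where
  "is_t_design t D \<longleftrightarrow> (\<exists>v k l. is_design t v k l D)"

definition flags :: "'p incidence_structure \<Rightarrow> ('p \<times> 'p set) set" where
  "flags D = {(p, B). p \<in> points D \<and> B \<in> blocks D \<and> p \<in> B}"

definition automorphisms :: "'p incidence_structure \<Rightarrow> ('p \<Rightarrow> 'p) set" where
  "automorphisms D = {f \<in> Bij (points D). (\<lambda>B. f ` B) ` blocks D = blocks D}"

text \<open>The group \<open>A\<close> acts on the points through \<open>\<phi>\<close>, as a group of automorphisms.\<close>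

definition flag_transitive ::
  "('g, 'z) monoid_scheme \<Rightarrow> ('g \<Rightarrow> 'p \<Rightarrow> 'p) \<Rightarrow> 'p incidence_structure \<Rightarrow> bool" where
  "flag_transitive A \<phi> D \<longleftrightarrow>
     group_action A (points D) \<phi> \<and>
     \<phi> ` carrier A \<subseteq> automorphisms D \<and>
     (\<forall>(p, B) \<in> flags D. \<forall>(q, B') \<in> flags D. \<exists>g \<in> carrier A. \<phi> g p = q \<and> \<phi> g ` B = B')"


text \<open>The two parts of the complete bipartite graph are enumerated without repetition by
  \<open>R, C :: nat \<Rightarrow> 'v\<close> on \<open>{1..m}\<close>; only these values of \<open>R\<close> and \<open>C\<close> matter.\<close>

definition bipartition :: "nat \<Rightarrow> (nat \<Rightarrow> 'v) \<Rightarrow> (nat \<Rightarrow> 'v) \<Rightarrow> bool" where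
  "bipartition m R C \<longleftrightarrow>
     inj_on R {1..m} \<and> inj_on C {1..m} \<and> R ` {1..m} \<inter> C ` {1..m} = {}"

abbreviation part :: "nat \<Rightarrow> (nat \<Rightarrow> 'v) \<Rightarrow> 'v set" where
  "part m X \<equiv> X ` {1..m}"

definition vertices :: "nat \<Rightarrow> (nat \<Rightarrow> 'v) \<Rightarrow> (nat \<Rightarrow> 'v) \<Rightarrow> 'v set" where
  "vertices m R C = part m R \<union> part m C"

definition pair_points :: "nat \<Rightarrow> (nat \<Rightarrow> 'v) \<Rightarrow> (nat \<Rightarrow> 'v) \<Rightarrow> ('v \<times> 'v) set" where
  "pair_points m R C = part m R \<times> part m C"

text \<open>Subgraphs are edge sets, an edge being an unordered pair of vertices.\<close>

definition block_of ::
  "nat \<Rightarrow> (nat \<Rightarrow> 'v) \<Rightarrow> (nat \<Rightarrow> 'v) \<Rightarrow> 'v set set \<Rightarrow> ('v \<times> 'v) set" where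
  "block_of m R C \<Delta> = {(x, y) \<in> pair_points m R C. {x, y} \<in> \<Delta>}"

definition graph_image :: "('v \<Rightarrow> 'v) \<Rightarrow> 'v set set \<Rightarrow> 'v set set" where
  "graph_image g \<Delta> = (\<lambda>e. g ` e) ` \<Delta>"

text \<open>Both groups are realised as groups of permutations of the vertex set. An element
  \<open>(\<sigma>, \<rho>)\<close> of the direct product of the two symmetric groups acts as \<open>\<sigma>\<close> on the first part
  and as \<open>\<rho>\<close> on the second.\<close>

definition pair_perm ::
  "nat \<Rightarrow> (nat \<Rightarrow> 'v) \<Rightarrow> (nat \<Rightarrow> 'v) \<Rightarrow> ('v \<Rightarrow> 'v) \<times> ('v \<Rightarrow> 'v) \<Rightarrow> 'v \<Rightarrow> 'v" where
  "pair_perm m R C = (\<lambda>(\<sigma>, \<rho>).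
     restrict (\<lambda>x. if x \<in> part m R then \<sigma> x else \<rho> x) (vertices m R C))"

definition group_K :: "nat \<Rightarrow> (nat \<Rightarrow> 'v) \<Rightarrow> (nat \<Rightarrow> 'v) \<Rightarrow> ('v \<Rightarrow> 'v) monoid" where
  "group_K m R C = (BijGroup (vertices m R C))
     \<lparr>carrier := pair_perm m R C ` carrier (BijGroup (part m R) \<times>\<times> BijGroup (part m C))\<rparr>"

definition swap_parts :: "nat \<Rightarrow> (nat \<Rightarrow> 'v) \<Rightarrow> (nat \<Rightarrow> 'v) \<Rightarrow> 'v \<Rightarrow> 'v" where
  "swap_parts m R C =
     restrict (\<lambda>x. if x \<in> part m R then C (the_inv_into {1..m} R x)
                   else R (the_inv_into {1..m} C x)) (vertices m R C)"

definition group_G :: "nat \<Rightarrow> (nat \<Rightarrow> 'v) \<Rightarrow> (nat \<Rightarrow> 'v) \<Rightarrow> ('v \<Rightarrow> 'v) monoid" where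
  "group_G m R C = (BijGroup (vertices m R C))
     \<lparr>carrier := generate (BijGroup (vertices m R C))
                  (insert (swap_parts m R C) (carrier (group_K m R C)))\<rparr>"

text \<open>The action on points is the action on edges, the image edge being written again with
  its end in the first part first. In particular \<open>swap_parts\<close> maps \<open>(R i, C j)\<close> to
  \<open>(R j, C i)\<close>, and elements of \<open>group_K\<close> act componentwise.\<close>

definition point_action ::
  "nat \<Rightarrow> (nat \<Rightarrow> 'v) \<Rightarrow> (nat \<Rightarrow> 'v) \<Rightarrow> ('v \<Rightarrow> 'v) \<Rightarrow> 'v \<times> 'v \<Rightarrow> 'v \<times> 'v" where
  "point_action m R C g =
     restrict (\<lambda>(x, y). if g x \<in> part m R then (g x, g y) else (g y, g x)) (pair_points m R C)"

definition design_K ::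
  "nat \<Rightarrow> (nat \<Rightarrow> 'v) \<Rightarrow> (nat \<Rightarrow> 'v) \<Rightarrow> 'v set set \<Rightarrow> ('v \<times> 'v) incidence_structure" where
  "design_K m R C \<Delta> =
     (pair_points m R C, {block_of m R C (graph_image g \<Delta>) | g. g \<in> carrier (group_K m R C)})"

definition design_G ::
  "nat \<Rightarrow> (nat \<Rightarrow> 'v) \<Rightarrow> (nat \<Rightarrow> 'v) \<Rightarrow> 'v set set \<Rightarrow> ('v \<times> 'v) incidence_structure" where
  "design_G m R C \<Delta> =
     (pair_points m R C, {block_of m R C (graph_image g \<Delta>) | g. g \<in> carrier (group_G m R C)})"

definition cycle_graph :: "nat \<Rightarrow> (nat \<Rightarrow> 'v) \<Rightarrow> (nat \<Rightarrow> 'v) \<Rightarrow> 'v set set" where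
  "cycle_graph a R C =
     {{R i, C i} | i. 1 \<le> i \<and> i \<le> a} \<union>
     {{R (i + 1), C i} | i. 1 \<le> i \<and> i \<le> a - 1} \<union>
     {{R 1, C a}}"

end

theory Submission
  imports Defs
begin

text \<open>The blocks are exactly the sets of edges of the \<open>2 a\<close>-cycles of the complete bipartite graph.
  A cycle can be rotated and reflected so that any prescribed edge comes first, and two labelled
  cycles differ by permutations of the two parts; this gives flag-transitivity, and invariance under
  transposition gives the same blocks for both groups.

  The number of blocks through two points depends only on whether the points agree in a coordinate.
  Fix a point on \<open>r\<close> blocks. Each of these blocks has one further point in the same row, one in the
  same column and \<open>k - 3\<close> others, so double counting shows that pairs in a line lie on
  \<open>r / (m - 1)\<close> blocks and the other pairs on \<open>r (k - 3) / (m - 1)\<^sup>2\<close> blocks. These agree iff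
  \<open>m = k - 2\<close>. A block through a point is determined by its labelling starting there, hence
  \<open>r = ((m - 1)! / (m - a)!)\<^sup>2\<close>.\<close>

section \<open>Permutations extending partial injections\<close>

lemma ex_bij_betw_extending:
  assumes "finite X" "A \<subseteq> X" "inj_on h A" "h ` A \<subseteq> X"
  shows "\<exists>\<sigma>. bij_betw \<sigma> X X \<and> (\<forall>x\<in>A. \<sigma> x = h x)"
proof -
  have "card (X - A) = card (X - h ` A)"
    using assms by (simp add: card_Diff_subset finite_subset card_image)
  then obtain e where e: "bij_betw e (X - A) (X - h ` A)"
    using assms(1) by (meson finite_Diff finite_same_card_bij)
  define \<sigma> where "\<sigma> x = (if x \<in> A then h x else e x)" for x
  have "bij_betw \<sigma> A (h ` A)"
    using assms(3) by (auto simp: bij_betw_def \<sigma>_def inj_on_def)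
  moreover have "bij_betw \<sigma> (X - A) (X - h ` A)"
    using e bij_betw_cong[of "X - A" \<sigma> e] by (simp add: \<sigma>_def)
  ultimately have "bij_betw \<sigma> (A \<union> (X - A)) (h ` A \<union> (X - h ` A))"
    by (rule bij_betw_combine) auto
  moreover have "A \<union> (X - A) = X" "h ` A \<union> (X - h ` A) = X"
    using assms by auto
  ultimately show ?thesis
    by (auto simp: \<sigma>_def)
qed

text \<open>The equivalence makes the assignment on \<open>{x, x'}\<close> both well defined and
  injective. It is applied to each coordinate when one pair of points is carried to another.\<close>

lemma ex_bij_betw_moving_pair:
  assumes "finite X" "{x, x', y, y'} \<subseteq> X" "x = x' \<longleftrightarrow> y = y'"
  shows "\<exists>\<sigma>. bij_betw \<sigma> X X \<and> \<sigma> x = y \<and> \<sigma> x' = y'"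
proof -
  have "\<exists>\<sigma>. bij_betw \<sigma> X X \<and> (\<forall>z\<in>{x, x'}. \<sigma> z = (if z = x then y else y'))"
    using assms by (intro ex_bij_betw_extending) (auto simp: inj_on_def)
  then show ?thesis
    using assms(3) by fastforce
qed

text \<open>A cycle of length \<open>2 n\<close> is labelled by \<open>n\<close>-periodic families indexed by the integers, so that
  rotating or reflecting it is an affine substitution of the index and no reduction modulo \<open>n\<close>
  is needed.\<close>

definition cyc_seqs :: "nat \<Rightarrow> 'a set \<Rightarrow> (int \<Rightarrow> 'a) set" where
  "cyc_seqs n X = {f. range f \<subseteq> X \<and> (\<forall>i j. f i = f j \<longleftrightarrow> int n dvd i - j)}"

text \<open>These are the edges of the closed walk \<open>f 0, g 0, f 1, g 1, ...\<close>, each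
  written with its end in the first part first.\<close>

definition cyc :: "(int \<Rightarrow> 'a) \<Rightarrow> (int \<Rightarrow> 'b) \<Rightarrow> ('a \<times> 'b) set" where
  "cyc f g = range (\<lambda>i. (f i, g i)) \<union> range (\<lambda>i. (f (i + 1), g i))"

definition cycles :: "nat \<Rightarrow> 'a set \<Rightarrow> 'b set \<Rightarrow> ('a \<times> 'b) set set" where
  "cycles n X Y = {cyc f g | f g. f \<in> cyc_seqs n X \<and> g \<in> cyc_seqs n Y}"

section \<open>Rotations, reflections and images of labelled cycles\<close>

lemma cyc_seqs_mem: "f \<in> cyc_seqs n X \<Longrightarrow> f i \<in> X"
  by (auto simp: cyc_seqs_def)

lemma cyc_seqs_eq_iff: "f \<in> cyc_seqs n X \<Longrightarrow> f i = f j \<longleftrightarrow> int n dvd i - j"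
  by (auto simp: cyc_seqs_def)

lemma cyc_seqs_mod: "f \<in> cyc_seqs n X \<Longrightarrow> f (i mod int n) = f i"
  by (simp add: cyc_seqs_eq_iff mod_eq_dvd_iff[symmetric])

lemma cyc_seqs_shift: "f \<in> cyc_seqs n X \<Longrightarrow> (\<lambda>i. f (c + i)) \<in> cyc_seqs n X"
  by (auto simp: cyc_seqs_def)

lemma cyc_seqs_reflect: "f \<in> cyc_seqs n X \<Longrightarrow> (\<lambda>i. f (c - i)) \<in> cyc_seqs n X"
  by (auto simp: cyc_seqs_def dvd_diff_commute)

lemma cyc_seqs_comp:
  assumes "f \<in> cyc_seqs n X" "inj_on \<sigma> X" "\<sigma> ` X \<subseteq> Z"
  shows "\<sigma> \<circ> f \<in> cyc_seqs n Z"
  using assms by (auto simp: cyc_seqs_def inj_on_eq_iff subset_eq image_iff)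

text \<open>Both sequences repeat at exactly the same pairs of indices, so sending
  \<open>f i\<close> to \<open>f' i\<close> is a well-defined injection on \<open>range f\<close>,
  whichever index the choice operator picks; it extends to a permutation.\<close>

lemma cyc_seqs_transitive:
  assumes "finite X" "f \<in> cyc_seqs n X" "f' \<in> cyc_seqs n X"
  shows "\<exists>\<sigma>. bij_betw \<sigma> X X \<and> \<sigma> \<circ> f = f'"
proof -
  define h where "h x = f' (SOME i. f i = x)" for x
  have h: "h (f i) = f' i" for i
    unfolding h_def using assms(2,3)
    by (metis (mono_tags, lifting) cyc_seqs_eq_iff someI_ex)
  have "inj_on h (range f)"
    using assms(2,3) by (auto simp: inj_on_def h cyc_seqs_eq_iff)
  moreover have "range f \<subseteq> X" "h ` range f \<subseteq> X"
    using assms(2,3) by (auto simp: h cyc_seqs_mem)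
  ultimately obtain \<sigma> where "bij_betw \<sigma> X X" "\<forall>x\<in>range f. \<sigma> x = h x"
    using ex_bij_betw_extending[OF assms(1)] by blast
  then show ?thesis
    by (auto simp: h fun_eq_iff intro!: exI[of _ \<sigma>])
qed

lemma range_surj_comp: "surj h \<Longrightarrow> range (\<lambda>i. P (h i)) = range P"
  using image_image[of P h UNIV] by simp

lemma cyc_shift: "cyc (\<lambda>i. f (c + i)) (\<lambda>i. g (c + i)) = cyc f g"
  unfolding cyc_def
  using range_surj_comp[of "(+) c" "\<lambda>i. (f i, g i)"]
    range_surj_comp[of "(+) c" "\<lambda>i. (f (i + 1), g i)"]
  by (simp add: add.assoc)

text \<open>Walking backwards exchanges the two families of edges. The offset \<open>c + 1\<close>
  for \<open>f\<close> against \<open>c\<close> for \<open>g\<close> puts the edge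
  \<open>(f (c + 1), g c)\<close> at index 0.\<close>

lemma cyc_reflect: "cyc (\<lambda>i. f (c + 1 - i)) (\<lambda>i. g (c - i)) = cyc f g"
proof -
  have "surj ((-) c)"
    by (rule surjI[of _ "(-) c"]) simp
  have "cyc (\<lambda>i. f (c + 1 - i)) (\<lambda>i. g (c - i)) =
      range (\<lambda>i. (f (c - i), g (c - i))) \<union> range (\<lambda>i. (f ((c - i) + 1), g (c - i)))"
    unfolding cyc_def by (simp add: algebra_simps Un_commute)
  also have "\<dots> = cyc f g"
    unfolding cyc_def
    using range_surj_comp[OF \<open>surj ((-) c)\<close>, of "\<lambda>i. (f i, g i)"]
      range_surj_comp[OF \<open>surj ((-) c)\<close>, of "\<lambda>i. (f (i + 1), g i)"]
    by simp
  finally show ?thesis .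
qed

text \<open>An edge \<open>(f i, g i)\<close> is brought to index 0 by a rotation, an edge
  \<open>(f (i + 1), g i)\<close> by a reflection. Hence all edges of a cycle are on the same
  footing.\<close>

lemma cycles_based_at:
  assumes "B \<in> cycles n X Y" "p \<in> B"
  shows "\<exists>f \<in> cyc_seqs n X. \<exists>g \<in> cyc_seqs n Y. B = cyc f g \<and> p = (f 0, g 0)"
proof -
  obtain f g where fg: "f \<in> cyc_seqs n X" "g \<in> cyc_seqs n Y" "B = cyc f g"
    using assms(1) by (auto simp: cycles_def)
  consider i where "p = (f i, g i)" | i where "p = (f (i + 1), g i)"
    using assms(2) fg(3) by (auto simp: cyc_def)
  then show ?thesis
  proof cases
    case 1
    with fg show ?thesis
      by (intro bexI[of _ "\<lambda>j. f (i + j)"] bexI[of _ "\<lambda>j. g (i + j)"])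
        (auto simp: cyc_shift cyc_seqs_shift)
  next
    case 2
    with fg show ?thesis
      by (intro bexI[of _ "\<lambda>j. f (i + 1 - j)"] bexI[of _ "\<lambda>j. g (i - j)"])
        (auto simp: cyc_reflect cyc_seqs_reflect)
  qed
qed

lemma cyc_image: "map_prod \<sigma> \<rho> ` cyc f g = cyc (\<sigma> \<circ> f) (\<rho> \<circ> g)"
  by (auto simp: cyc_def image_Un image_image)

lemma cyc_swap: "prod.swap ` cyc f g = cyc (\<lambda>i. g (- i)) (\<lambda>i. f (- i))"
proof -
  have "prod.swap ` cyc f g = range (\<lambda>i. (g i, f i)) \<union> range (\<lambda>i. (g i, f (i + 1)))"
    by (auto simp: cyc_def image_Un image_image)
  also have "range (\<lambda>i. (g i, f i)) = range (\<lambda>i. (g (- i), f (- i)))"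
    by (rule range_surj_comp[symmetric]) (rule surjI[of _ uminus], simp)
  \<comment> \<open>Substituting \<open>- i - 1\<close> gives \<open>g (- (i + 1))\<close> and
    \<open>f (- i)\<close>, which is the second family of edges for the reversed labels.\<close>
  also have "range (\<lambda>i. (g i, f (i + 1))) = range (\<lambda>i. (g (- i - 1), f (- i - 1 + 1)))"
    by (rule range_surj_comp[symmetric]) (rule surjI[of _ "\<lambda>i. - i - 1"], simp)
  finally show ?thesis
    by (simp add: cyc_def)
qed

lemma cycles_image:
  assumes "bij_betw \<sigma> X X'" "bij_betw \<rho> Y Y'" "B \<in> cycles n X Y"
  shows "map_prod \<sigma> \<rho> ` B \<in> cycles n X' Y'"
proof -
  obtain f g where fg: "f \<in> cyc_seqs n X" "g \<in> cyc_seqs n Y" "B = cyc f g"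
    using assms(3) by (auto simp: cycles_def)
  have "\<sigma> \<circ> f \<in> cyc_seqs n X'" "\<rho> \<circ> g \<in> cyc_seqs n Y'"
    using assms(1,2) fg(1,2) by (auto simp: bij_betw_def intro!: cyc_seqs_comp)
  then show ?thesis
    unfolding fg(3) cyc_image cycles_def by blast
qed

lemma cycles_swap:
  assumes "B \<in> cycles n X Y"
  shows "prod.swap ` B \<in> cycles n Y X"
proof -
  obtain f g where fg: "f \<in> cyc_seqs n X" "g \<in> cyc_seqs n Y" "B = cyc f g"
    using assms by (auto simp: cycles_def)
  have "(\<lambda>i. g (- i)) \<in> cyc_seqs n Y" "(\<lambda>i. f (- i)) \<in> cyc_seqs n X"
    using fg(1,2)[THEN cyc_seqs_reflect, of 0] by simp_all
  then show ?thesis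
    unfolding fg(3) cyc_swap cycles_def by blast
qed

lemma cycles_subset: "B \<in> cycles n X Y \<Longrightarrow> B \<subseteq> X \<times> Y"
  by (auto simp: cycles_def cyc_def dest: cyc_seqs_mem)

lemma finite_cycles: "finite X \<Longrightarrow> finite Y \<Longrightarrow> finite (cycles n X Y)"
  by (rule finite_subset[of _ "Pow (X \<times> Y)"]) (auto dest: cycles_subset)

section \<open>Size, vertex degrees and rigidity of a cycle\<close>

lemma periodic_range:
  assumes "n > 0" "\<And>i. h (i mod int n) = h i"
  shows "range h = h ` {0..<int n}"
proof
  show "range h \<subseteq> h ` {0..<int n}"
  proof safe
    fix i
    have "h i = h (i mod int n)" "i mod int n \<in> {0..<int n}"
      using assms by auto
    then show "h i \<in> h ` {0..<int n}" by blast
  qed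
qed auto

lemma cyc_seqs_mod_add: "f \<in> cyc_seqs n X \<Longrightarrow> f (i mod int n + c) = f (i + c)"
  by (simp add: cyc_seqs_eq_iff mod_eq_dvd_iff[symmetric])

text \<open>One period of indices gives \<open>n\<close> edges in each of the two families, and for
  \<open>n \<ge> 2\<close> the families are disjoint.\<close>

lemma card_cycles:
  assumes "n \<ge> 2" "B \<in> cycles n X Y"
  shows "card B = 2 * n"
proof -
  obtain f g where fg: "f \<in> cyc_seqs n X" "g \<in> cyc_seqs n Y" "B = cyc f g"
    using assms(2) by (auto simp: cycles_def)
  let ?I = "{0..<int n}"
  have *: "i = j" if "int n dvd i - j" "i \<in> ?I" "j \<in> ?I" for i j
    using that zdvd_imp_le[of "int n" "i - j"] zdvd_imp_le[of "int n" "j - i"]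
    by (force simp: dvd_diff_commute)
  have "B = (\<lambda>i. (f i, g i)) ` ?I \<union> (\<lambda>i. (f (i + 1), g i)) ` ?I"
    unfolding fg(3) cyc_def using assms(1) fg(1,2)
    by (intro arg_cong2[of _ _ _ _ "(\<union>)"] periodic_range)
      (auto simp: cyc_seqs_mod cyc_seqs_mod_add)
  moreover have "(\<lambda>i. (f i, g i)) ` ?I \<inter> (\<lambda>i. (f (i + 1), g i)) ` ?I = {}"
  proof -
    have False if "f i = f (j + 1)" "g i = g j" for i j
    proof -
      have "int n dvd i - (j + 1)" "int n dvd i - j"
        using that fg(1,2) by (auto simp: cyc_seqs_eq_iff)
      \<comment> \<open>This difference is 1, which \<open>n \<ge> 2\<close> does not
        divide.\<close>
      then have "int n dvd (i - j) - (i - (j + 1))"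
        using dvd_diff by blast
      with assms(1) show False by simp
    qed
    then show ?thesis by auto
  qed
  moreover have "inj_on (\<lambda>i. (f i, g i)) ?I" "inj_on (\<lambda>i. (f (i + 1), g i)) ?I"
    using fg(1,2) * by (auto simp: inj_on_def cyc_seqs_eq_iff)
  ultimately show ?thesis
    by (simp add: card_Un_disjoint card_image)
qed

lemma cyc_seqs_neq: "\<lbrakk>n \<ge> 2; f \<in> cyc_seqs n X\<rbrakk> \<Longrightarrow> f 0 \<noteq> f 1 \<and> f 0 \<noteq> f (-1)"
  by (auto simp: cyc_seqs_eq_iff)

text \<open>Together with \<open>cyc_col\<close> this says that each vertex on the cycle has degree
  two, its neighbours being the ones just before and just after it on the walk. Uniqueness of
  labellings and the neighbour counts rest on it.\<close>

lemma cyc_row: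
  assumes "f \<in> cyc_seqs n X" "g \<in> cyc_seqs n Y"
  shows "(f i, y) \<in> cyc f g \<longleftrightarrow> y = g i \<or> y = g (i - 1)"
proof
  assume "(f i, y) \<in> cyc f g"
  then consider j where "f i = f j" "y = g j" | j where "f i = f (j + 1)" "y = g j"
    by (auto simp: cyc_def)
  then show "y = g i \<or> y = g (i - 1)"
    by cases (use assms in \<open>auto simp: cyc_seqs_eq_iff algebra_simps\<close>)
next
  assume "y = g i \<or> y = g (i - 1)"
  moreover have "(f i, g (i - 1)) = (f ((i - 1) + 1), g (i - 1))"
    by simp
  ultimately show "(f i, y) \<in> cyc f g"
    unfolding cyc_def by blast
qed

lemma cyc_col:
  assumes "f \<in> cyc_seqs n X" "g \<in> cyc_seqs n Y"
  shows "(x, g i) \<in> cyc f g \<longleftrightarrow> x = f i \<or> x = f (i + 1)"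
proof
  assume "(x, g i) \<in> cyc f g"
  then consider j where "g i = g j" "x = f j" | j where "g i = g j" "x = f (j + 1)"
    by (auto simp: cyc_def)
  then show "x = f i \<or> x = f (i + 1)"
    by cases (use assms in \<open>auto simp: cyc_seqs_eq_iff algebra_simps\<close>)
next
  assume "x = f i \<or> x = f (i + 1)"
  then show "(x, g i) \<in> cyc f g"
    unfolding cyc_def by blast
qed

text \<open>The common base edge fixes both the start and the direction of the walk. From then on
  each vertex has only one neighbour other than the one just left, so the edge set determines every
  label.\<close>

lemma cyc_inj:
  assumes "n \<ge> 2" "f \<in> cyc_seqs n X" "g \<in> cyc_seqs n Y" "f' \<in> cyc_seqs n X" "g' \<in> cyc_seqs n Y"
    and "cyc f g = cyc f' g'" "f 0 = f' 0" "g 0 = g' 0"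
  shows "f = f' \<and> g = g'"
proof -
  have nat: "f (int k) = f' (int k) \<and> g (int k) = g' (int k)" for k
  proof (induction k)
    case 0
    then show ?case using assms by simp
  next
    case (Suc k)
    have "int k + 1 = int (Suc k)" by simp
    \<comment> \<open>The next vertex differs from the previous one, so of the two neighbours
      supplied by \<open>cyc_col\<close> or \<open>cyc_row\<close> only the new one remains.\<close>
    have f_neq: "f (int k + 1) \<noteq> f (int k)" and g_neq: "g (int k + 1) \<noteq> g (int k)"
      using assms(1-3) by (auto simp: cyc_seqs_eq_iff)
    have "(f (int k + 1), g' (int k)) \<in> cyc f' g'"
      using cyc_col[OF assms(2,3)] Suc assms(6) by metis
    then have f: "f (int k + 1) = f' (int k + 1)"
      using cyc_col[OF assms(4,5)] Suc f_neq by metis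
    have "(f' (int k + 1), g (int k + 1)) \<in> cyc f' g'"
      using cyc_row[OF assms(2,3), of "int k + 1"] f assms(6) by metis
    then have "g (int k + 1) = g' (int k + 1)"
      using cyc_row[OF assms(4,5), of "int k + 1"] Suc g_neq by simp
    with f show ?case by (simp add: add.commute)
  qed
  \<comment> \<open>Negative indices are reached through their residues modulo \<open>n\<close>,
    which are natural numbers.\<close>
  have "f i = f' i \<and> g i = g' i" for i
  proof -
    have "int (nat (i mod int n)) = i mod int n"
      using assms(1) by simp
    then have "f (i mod int n) = f' (i mod int n) \<and> g (i mod int n) = g' (i mod int n)"
      using nat[of "nat (i mod int n)"] by simp
    then show ?thesis
      using assms(2-5) by (simp add: cyc_seqs_mod)
  qed
  then show ?thesis by auto
qed

section \<open>Counting labellings with a prescribed start\<close>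

text \<open>The indices \<open>1, ..., n - 1\<close> carry distinct elements of
  \<open>X - {x}\<close>, chosen freely, and periodicity fixes the rest. If
  \<open>n > card X\<close>, no such sequence exists and the product has a zero factor.\<close>

lemma card_cyc_seqs_based:
  assumes "finite X" "x \<in> X" "0 < n"
  shows "card {f \<in> cyc_seqs n X. f 0 = x} = (\<Prod>i = 0..<n - 1. card X - 1 - i)"
proof -
  let ?J = "{1..<int n}"
  let ?S = "{h \<in> ?J \<rightarrow>\<^sub>E (X - {x}). inj_on h ?J}"
  \<comment> \<open>The inverse of restriction to \<open>?J\<close>: residue 0 receives the base
    value \<open>x\<close>, all other residues are read off from \<open>h\<close>.\<close>
  define ext where "ext h i = (if i mod int n = 0 then x else h (i mod int n))" for h and i :: int
  have J: "i mod int n \<in> ?J" if "i mod int n \<noteq> 0" for i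
    unfolding atLeastLessThan_iff
    using that assms(3) pos_mod_bound[of "int n" i] pos_mod_sign[of "int n" i] by linarith
  have small: "i = j" if "int n dvd i - j" "i \<in> {0..<int n}" "j \<in> {0..<int n}" for i j
  proof -
    have "i mod int n = j mod int n"
      using that(1) by (simp only: mod_eq_dvd_iff)
    then show ?thesis
      using that(2,3) by simp
  qed
  have "bij_betw (\<lambda>f. restrict f ?J) {f \<in> cyc_seqs n X. f 0 = x} ?S"
  proof (rule bij_betw_byWitness[where f' = ext])
    show "\<forall>f \<in> {f \<in> cyc_seqs n X. f 0 = x}. ext (restrict f ?J) = f"
    proof (intro ballI HOL.ext)
      fix f i assume "f \<in> {f \<in> cyc_seqs n X. f 0 = x}"
      then have "f (i mod int n) = f i" "f 0 = x"
        using cyc_seqs_mod by auto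
      then show "ext (restrict f ?J) i = f i"
        using J[of i] by (cases "i mod int n = 0") (simp_all add: ext_def)
    qed
    show "\<forall>h \<in> ?S. restrict (ext h) ?J = h"
    proof (intro ballI HOL.ext)
      fix h i assume "h \<in> ?S"
      then have "h \<in> extensional ?J"
        by (simp add: PiE_def)
      then show "restrict (ext h) ?J i = h i"
        by (cases "i \<in> ?J") (auto simp: ext_def extensional_def)
    qed
    show "(\<lambda>f. restrict f ?J) ` {f \<in> cyc_seqs n X. f 0 = x} \<subseteq> ?S"
    proof (intro image_subsetI CollectI conjI)
      fix f assume "f \<in> {f \<in> cyc_seqs n X. f 0 = x}"
      then have f: "f \<in> cyc_seqs n X" "f 0 = x" by auto
      have "f i \<noteq> x" if "i \<in> ?J" for i
        using cyc_seqs_eq_iff[OF f(1), of i 0] small[of i 0] that f(2) by auto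
      then show "restrict f ?J \<in> ?J \<rightarrow>\<^sub>E X - {x}"
        using cyc_seqs_mem[OF f(1)] by (intro restrict_PiE_iff[THEN iffD2]) simp
      show "inj_on (restrict f ?J) ?J"
      proof (rule inj_onI)
        fix i j assume "i \<in> ?J" "j \<in> ?J" "restrict f ?J i = restrict f ?J j"
        then show "i = j"
          using cyc_seqs_eq_iff[OF f(1), of i j] small[of i j] by simp
      qed
    qed
    show "ext ` ?S \<subseteq> {f \<in> cyc_seqs n X. f 0 = x}"
    proof (intro image_subsetI CollectI conjI)
      fix h assume "h \<in> ?S"
      then have h: "h \<in> ?J \<rightarrow>\<^sub>E X - {x}" "inj_on h ?J" by auto
      note mem = PiE_mem[OF h(1) J] and inj = inj_on_eq_iff[OF h(2) J J]
      show "ext h 0 = x" by (simp add: ext_def)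
      have "ext h i = ext h j \<longleftrightarrow> i mod int n = j mod int n" for i j
        using mem[of i] mem[of j] inj[of i j]
        by (cases "i mod int n = 0"; cases "j mod int n = 0") (auto simp: ext_def)
      moreover have "ext h i \<in> X" for i
        using mem[of i] assms(2) by (simp add: ext_def)
      ultimately show "ext h \<in> cyc_seqs n X"
        by (auto simp: cyc_seqs_def mod_eq_dvd_iff)
    qed
  qed
  then have "card {f \<in> cyc_seqs n X. f 0 = x} = card ?S"
    by (rule bij_betw_same_card)
  also have "card ?J = n - 1" using assms(3) by simp
  then have "card ?S = (\<Prod>i = 0..<n - 1. card X - 1 - i)"
    using card_inj_on_subset_funcset[of ?J "X - {x}" ?J] assms by (simp add: nat_diff_distrib')
  finally show ?thesis .
qed

text \<open>The quotient \<open>M! / (M - k)!\<close> in a form without division;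
  \<open>k \<le> M\<close> keeps the subtractions from truncating.\<close>

lemma prod_falling_times_fact: "k \<le> M \<Longrightarrow> (\<Prod>i = 0..<k. M - i) * fact (M - k) = (fact M :: nat)"
proof (induction k)
  case (Suc k)
  then have "fact (M - k) = (M - k) * (fact (M - Suc k) :: nat)"
    by (metis Suc_diff_Suc Suc_le_lessD fact_Suc of_nat_id)
  with Suc show ?case by (simp add: mult.assoc)
qed simp

section \<open>Design parameters of the set of all cycles\<close>

locale cycle_design =
  fixes n :: nat and X :: "'a set" and Y :: "'b set"
  assumes finite_X: "finite X" and finite_Y: "finite Y" and card_Y: "card Y = card X"
    and n_ge: "n \<ge> 2" and n_le: "n \<le> card X"
begin

definition pair_degree :: "'a \<times> 'b \<Rightarrow> 'a \<times> 'b \<Rightarrow> nat" where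
  "pair_degree p q = card {B \<in> cycles n X Y. p \<in> B \<and> q \<in> B}"

text \<open>Permutations of the two parts carrying \<open>p, q\<close> to \<open>p', q'\<close> map
  the cycles through the first pair injectively to cycles through the second. The hypotheses are
  symmetric in the two pairs, so equality follows.\<close>

lemma pair_degree_le:
  assumes "{p, q, p', q'} \<subseteq> X \<times> Y"
    and "fst p = fst q \<longleftrightarrow> fst p' = fst q'" "snd p = snd q \<longleftrightarrow> snd p' = snd q'"
  shows "pair_degree p q \<le> pair_degree p' q'"
proof -
  obtain \<sigma> where \<sigma>: "bij_betw \<sigma> X X" "\<sigma> (fst p) = fst p'" "\<sigma> (fst q) = fst q'"
    using ex_bij_betw_moving_pair[OF finite_X, of "fst p" "fst q" "fst p'" "fst q'"] assms
    by auto
  obtain \<rho> where \<rho>: "bij_betw \<rho> Y Y" "\<rho> (snd p) = snd p'" "\<rho> (snd q) = snd q'"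
    using ex_bij_betw_moving_pair[OF finite_Y, of "snd p" "snd q" "snd p'" "snd q'"] assms
    by auto
  let ?\<phi> = "map_prod \<sigma> \<rho>"
  have \<phi>: "?\<phi> p = p'" "?\<phi> q = q'"
    using \<sigma> \<rho> by (simp_all add: map_prod_def split_beta)
  have "inj_on ?\<phi> (X \<times> Y)"
    using \<sigma>(1) \<rho>(1) by (auto simp: inj_on_def bij_betw_def)
  then have "inj_on ((`) ?\<phi>) (cycles n X Y)"
    by (rule inj_on_subset[OF inj_on_image_Pow]) (auto dest: cycles_subset)
  moreover have "(`) ?\<phi> ` {B \<in> cycles n X Y. p \<in> B \<and> q \<in> B}
      \<subseteq> {B \<in> cycles n X Y. p' \<in> B \<and> q' \<in> B}"
    using cycles_image[OF \<sigma>(1) \<rho>(1)] imageI[of p _ ?\<phi>] imageI[of q _ ?\<phi>]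
    unfolding \<phi> by (intro image_subsetI) simp
  ultimately show ?thesis
    unfolding pair_degree_def using finite_cycles[OF finite_X finite_Y, of n]
    by (intro card_inj_on_le[of "(`) ?\<phi>"]) (auto intro: inj_on_subset)
qed

lemma pair_degree_eq:
  assumes "{p, q, p', q'} \<subseteq> X \<times> Y"
    and "fst p = fst q \<longleftrightarrow> fst p' = fst q'" "snd p = snd q \<longleftrightarrow> snd p' = snd q'"
  shows "pair_degree p q = pair_degree p' q'"
  using pair_degree_le[of p q p' q'] pair_degree_le[of p' q' p q] assms by force

text \<open>By \<open>cycles_based_at\<close> and \<open>cyc_inj\<close> a cycle through
  \<open>p\<close> has exactly one labelling with \<open>p\<close> at index 0, so the cycles through
  \<open>p\<close> correspond to pairs of based sequences.\<close>

lemma pair_degree_self: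
  assumes "p \<in> X \<times> Y"
  shows "pair_degree p p = (\<Prod>i = 0..<n - 1. card X - 1 - i)\<^sup>2"
proof -
  obtain x y where p: "p = (x, y)" "x \<in> X" "y \<in> Y" using assms by auto
  let ?F = "{f \<in> cyc_seqs n X. f 0 = x}" and ?G = "{g \<in> cyc_seqs n Y. g 0 = y}"
  have "bij_betw (\<lambda>(f, g). cyc f g) (?F \<times> ?G) {B \<in> cycles n X Y. p \<in> B}"
    unfolding bij_betw_def
  proof
    show "inj_on (\<lambda>(f, g). cyc f g) (?F \<times> ?G)"
    proof (rule inj_onI)
      fix s s'
      assume "s \<in> ?F \<times> ?G" "s' \<in> ?F \<times> ?G"
        and eq: "(\<lambda>(f, g). cyc f g) s = (\<lambda>(f, g). cyc f g) s'"
      then obtain f g f' g' where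
        mem: "f \<in> cyc_seqs n X" "g \<in> cyc_seqs n Y" "f' \<in> cyc_seqs n X" "g' \<in> cyc_seqs n Y"
        and zero: "f 0 = x" "g 0 = y" "f' 0 = x" "g' 0 = y" and s: "s = (f, g)" "s' = (f', g')"
        by blast
      have "cyc f g = cyc f' g'" "f 0 = f' 0" "g 0 = g' 0"
        using eq zero by (simp_all add: s)
      from cyc_inj[OF n_ge mem this] show "s = s'"
        by (simp add: s)
    qed
    show "(\<lambda>(f, g). cyc f g) ` (?F \<times> ?G) = {B \<in> cycles n X Y. p \<in> B}" (is "?L = ?R")
    proof
      show "?L \<subseteq> ?R"
        by (auto simp: cycles_def cyc_def p)
      show "?R \<subseteq> ?L"
      proof clarify
        fix B assume "B \<in> cycles n X Y" "p \<in> B"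
        then obtain f g where "f \<in> cyc_seqs n X" "g \<in> cyc_seqs n Y" "B = cyc f g" "p = (f 0, g 0)"
          by (metis cycles_based_at)
        then show "B \<in> ?L"
          using p(1) by (intro image_eqI[of _ _ "(f, g)"]) auto
      qed
    qed
  qed
  then have "pair_degree p p = card ?F * card ?G"
    by (simp add: pair_degree_def bij_betw_same_card[symmetric] card_cartesian_product)
  also have "\<dots> = (\<Prod>i = 0..<n - 1. card X - 1 - i)\<^sup>2"
    using card_cyc_seqs_based[OF finite_X p(2), of n] card_cyc_seqs_based[OF finite_Y p(3), of n]
      n_ge card_Y by (simp add: power2_eq_square)
  finally show ?thesis .
qed

lemma pair_degree_self_fact:
  assumes "p \<in> X \<times> Y"
  shows "pair_degree p p * (fact (card X - n))\<^sup>2 = (fact (card X - 1))\<^sup>2"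
proof -
  have "card X - 1 - (n - 1) = card X - n"
    using n_ge by simp
  then show ?thesis
    using prod_falling_times_fact[of "n - 1" "card X - 1"] n_le n_ge
    by (simp add: pair_degree_self[OF assms] flip: power_mult_distrib)
qed

lemma pair_degree_self_pos: "p \<in> X \<times> Y \<Longrightarrow> pair_degree p p > 0"
  using pair_degree_self_fact[of p] by (metis fact_nonzero gr0I mult_is_0 power_not_zero)

text \<open>Both sides count the pairs \<open>(q, B)\<close> with \<open>q \<in> Q\<close> and
  \<open>B\<close> a cycle through \<open>p\<close> and \<open>q\<close>.\<close>

lemma double_count:
  assumes "finite Q" "\<And>q. q \<in> Q \<Longrightarrow> pair_degree p q = l"
    and "\<And>B. B \<in> cycles n X Y \<Longrightarrow> p \<in> B \<Longrightarrow> card (Q \<inter> B) = c"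
  shows "card Q * l = c * pair_degree p p"
proof -
  let ?S = "{B \<in> cycles n X Y. p \<in> B}"
  have "card Q * l = (\<Sum>q\<in>Q. card {B \<in> ?S. q \<in> B})"
    using assms(2) by (simp add: pair_degree_def conj_assoc)
  also have "\<dots> = c * card ?S"
    using assms(1,3) finite_cycles[OF finite_X finite_Y, of n]
    by (intro sum_multicount) (auto simp: Int_def)
  finally show ?thesis by (simp add: pair_degree_def)
qed

text \<open>With \<open>(x, y)\<close> at index 0, the adjacent edges are
  \<open>(f 0, g (-1))\<close> in its row and \<open>(f 1, g 0)\<close> in its column. Removing
  these three from the \<open>2 * n\<close> edges leaves those that share no end with
  \<open>(x, y)\<close>.\<close>

lemma neighbours_in_cycle:
  assumes "B \<in> cycles n X Y" "(x, y) \<in> B"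
  shows "card ({x} \<times> (Y - {y}) \<inter> B) = 1" "card ((X - {x}) \<times> {y} \<inter> B) = 1"
    and "card ((X - {x}) \<times> (Y - {y}) \<inter> B) = 2 * n - 3"
proof -
  obtain f g where fg: "f \<in> cyc_seqs n X" "g \<in> cyc_seqs n Y" "B = cyc f g" "x = f 0" "y = g 0"
    using cycles_based_at[OF assms] by auto
  have neq: "f 1 \<noteq> f 0" "g (-1) \<noteq> g 0"
    using cyc_seqs_neq[OF n_ge fg(1)] cyc_seqs_neq[OF n_ge fg(2)] by auto
  have row: "{x} \<times> (Y - {y}) \<inter> B = {(f 0, g (-1))}"
    using neq cyc_row[OF fg(1,2), of 0] cyc_seqs_mem[OF fg(2)] fg(3-5) by auto
  have col: "(X - {x}) \<times> {y} \<inter> B = {(f 1, g 0)}"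
    using neq cyc_col[OF fg(1,2), of _ 0] cyc_seqs_mem[OF fg(1)] fg(3-5) by auto
  from row show "card ({x} \<times> (Y - {y}) \<inter> B) = 1" by simp
  from col show "card ((X - {x}) \<times> {y} \<inter> B) = 1" by simp
  let ?N = "{(f 0, g 0), (f 0, g (-1)), (f 1, g 0)}"
  have "(X - {x}) \<times> (Y - {y}) \<inter> B = B - ?N"
    using row col cycles_subset[OF assms(1)] fg(4,5) by blast
  moreover have "?N \<subseteq> B" "card ?N = 3"
    using row col assms(2) fg(4,5) neq by auto
  ultimately show "card ((X - {x}) \<times> (Y - {y}) \<inter> B) = 2 * n - 3"
    using card_cycles[OF n_ge assms(1)] by (simp add: card_Diff_subset)
qed

text \<open>Double counting with \<open>Q\<close> the rest of the row, on which the pair degree is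
  constant by \<open>pair_degree_eq\<close>. The next two lemmas take for \<open>Q\<close> the rest
  of the column and the points off both lines.\<close>

lemma pair_degree_row:
  assumes "x \<in> X" "y \<in> Y" "y' \<in> Y" "y \<noteq> y'"
  shows "(card X - 1) * pair_degree (x, y) (x, y') = pair_degree (x, y) (x, y)"
proof -
  have "card ({x} \<times> (Y - {y})) * pair_degree (x, y) (x, y') = 1 * pair_degree (x, y) (x, y)"
  proof (rule double_count)
    show "pair_degree (x, y) q = pair_degree (x, y) (x, y')" if "q \<in> {x} \<times> (Y - {y})" for q
      using that assms by (intro pair_degree_eq) auto
  qed (use finite_Y neighbours_in_cycle(1) in auto)
  then show ?thesis
    using assms finite_Y card_Y by (simp add: card_cartesian_product)
qed

lemma pair_degree_col:
  assumes "x \<in> X" "y \<in> Y" "x' \<in> X" "x \<noteq> x'"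
  shows "(card X - 1) * pair_degree (x, y) (x', y) = pair_degree (x, y) (x, y)"
proof -
  have "card ((X - {x}) \<times> {y}) * pair_degree (x, y) (x', y) = 1 * pair_degree (x, y) (x, y)"
  proof (rule double_count)
    show "pair_degree (x, y) q = pair_degree (x, y) (x', y)" if "q \<in> (X - {x}) \<times> {y}" for q
      using that assms by (intro pair_degree_eq) auto
  qed (use finite_X neighbours_in_cycle(2) in auto)
  then show ?thesis
    using assms finite_X by (simp add: card_cartesian_product)
qed

lemma pair_degree_disjoint:
  assumes "x \<in> X" "y \<in> Y" "x' \<in> X" "y' \<in> Y" "x \<noteq> x'" "y \<noteq> y'"
  shows "(card X - 1)\<^sup>2 * pair_degree (x, y) (x', y') = (2 * n - 3) * pair_degree (x, y) (x, y)"
proof -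
  have "card ((X - {x}) \<times> (Y - {y})) * pair_degree (x, y) (x', y') = (2 * n - 3) * pair_degree (x, y) (x, y)"
  proof (rule double_count)
    show "pair_degree (x, y) q = pair_degree (x, y) (x', y')" if "q \<in> (X - {x}) \<times> (Y - {y})" for q
      using that assms by (intro pair_degree_eq) auto
  qed (use finite_X finite_Y neighbours_in_cycle(3) in auto)
  then show ?thesis
    using assms finite_X finite_Y card_Y by (simp add: card_cartesian_product power2_eq_square)
qed

lemma card_X_ge_2: "card X \<ge> 2"
  using n_ge n_le by simp

lemma ex_points: obtains x x' y y' where "x \<in> X" "x' \<in> X" "x \<noteq> x'" "y \<in> Y" "y' \<in> Y" "y \<noteq> y'"
proof -
  obtain Z where "Z \<subseteq> X" "card Z = 2"
    by (rule obtain_subset_with_card_n[OF card_X_ge_2])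
  moreover obtain W where "W \<subseteq> Y" "card W = 2"
    by (rule obtain_subset_with_card_n[OF card_X_ge_2[folded card_Y]])
  ultimately show ?thesis
    unfolding card_2_iff by (elim exE conjE) (rule that; blast)
qed

abbreviation design :: "('a \<times> 'b) incidence_structure" where
  "design \<equiv> (X \<times> Y, cycles n X Y)"

lemma is_design_iff:
  "is_design t v k l design \<longleftrightarrow>
     t > 0 \<and> l > 0 \<and> v = (card X)\<^sup>2 \<and> k = 2 * n \<and>
     (\<forall>T \<subseteq> X \<times> Y. card T = t \<longrightarrow> card {B \<in> cycles n X Y. T \<subseteq> B} = l)"
proof -
  obtain x y where "x \<in> X" "y \<in> Y" using ex_points by metis
  \<comment> \<open>Some block has to exist, as otherwise every \<open>k\<close> would pass
    vacuously as the block size.\<close>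
  then obtain B where "B \<in> cycles n X Y"
    using pair_degree_self_pos[of "(x, y)"] by (auto simp: pair_degree_def card_gt_0_iff)
  then have "(\<forall>B\<in>cycles n X Y. card B = k) \<longleftrightarrow> k = 2 * n"
    using card_cycles[OF n_ge, of _ X Y] by auto
  then show ?thesis
    using n_ge card_X_ge_2 finite_X finite_Y card_Y
    by (auto simp: is_design_def card_cartesian_product power2_eq_square dest: cycles_subset)
qed

lemma is_design_1: "\<exists>l. is_design 1 ((card X)\<^sup>2) (2 * n) l design"
proof -
  obtain x y where xy: "x \<in> X" "y \<in> Y" using ex_points by metis
  have "card {B \<in> cycles n X Y. T \<subseteq> B} = pair_degree (x, y) (x, y)" if T: "T \<subseteq> X \<times> Y" "card T = 1" for T
  proof -
    obtain p where "T = {p}" using T(2) by (auto simp: card_1_singleton_iff)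
    then have "card {B \<in> cycles n X Y. T \<subseteq> B} = pair_degree p p"
      by (simp add: pair_degree_def)
    also have "\<dots> = pair_degree (x, y) (x, y)"
      using T(1) xy \<open>T = {p}\<close> by (intro pair_degree_eq) auto
    finally show ?thesis .
  qed
  then show ?thesis
    using xy pair_degree_self_pos[of "(x, y)"] by (auto simp: is_design_iff)
qed

text \<open>No cycle has three edges at a vertex.\<close>

lemma not_is_design_3:
  assumes "card X \<ge> 3"
  shows "\<not> is_design 3 v k l design"
proof
  assume design: "is_design 3 v k l design"
  obtain x where "x \<in> X" using ex_points by metis
  obtain Z where Z: "Z \<subseteq> Y" "card Z = 3"
    using assms card_Y obtain_subset_with_card_n by metis
  let ?T = "{x} \<times> Z"
  have "?T \<subseteq> X \<times> Y" "card ?T = 3"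
    using \<open>x \<in> X\<close> Z by (auto simp: card_cartesian_product)
  \<comment> \<open>Designs have positive \<open>l\<close>, so three points of one row would have to
    share a block.\<close>
  then have "card {B \<in> cycles n X Y. ?T \<subseteq> B} > 0"
    using design by (auto simp: is_design_iff)
  then obtain B where B: "B \<in> cycles n X Y" "?T \<subseteq> B"
    by (auto simp: card_gt_0_iff)
  obtain y where "y \<in> Z" using Z(2) by fastforce
  \<comment> \<open>Two further points of the row would lie in \<open>B\<close>, which has only
    one.\<close>
  have "card ({x} \<times> (Z - {y})) \<le> card ({x} \<times> (Y - {y}) \<inter> B)"
    using Z(1) B(2) finite_Y by (intro card_mono) auto
  then show False
    using neighbours_in_cycle(1)[OF B(1), of x y] B(2) \<open>y \<in> Z\<close> Z(2)
    by (auto simp: card_cartesian_product)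
qed

lemma is_design_2_imp:
  assumes "is_design 2 v k l design"
  shows "card X = 2 * n - 2"
proof -
  obtain x x' y y' where xy: "x \<in> X" "x' \<in> X" "x \<noteq> x'" "y \<in> Y" "y' \<in> Y" "y \<noteq> y'"
    by (rule ex_points)
  have pair_degree: "pair_degree p q = l" if "p \<noteq> q" "p \<in> X \<times> Y" "q \<in> X \<times> Y" for p q
  proof -
    have "{p, q} \<subseteq> X \<times> Y" "card {p, q} = 2"
      using that by auto
    then have "card {B \<in> cycles n X Y. {p, q} \<subseteq> B} = l"
      using assms unfolding is_design_iff by blast
    then show ?thesis by (simp add: pair_degree_def)
  qed
  have "(card X - 1) * l = pair_degree (x, y) (x, y)"
    using pair_degree_row[of x y y'] pair_degree[of "(x, y)" "(x, y')"] xy by simp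
  moreover have "(card X - 1) * ((card X - 1) * l) = (2 * n - 3) * pair_degree (x, y) (x, y)"
    using pair_degree_disjoint[of x y x' y'] pair_degree[of "(x, y)" "(x', y')"] xy
    by (simp add: power2_eq_square)
  \<comment> \<open>Substituting the first equation into the second leaves the positive factor
    \<open>pair_degree (x, y) (x, y)\<close> on both sides.\<close>
  ultimately have "card X - 1 = 2 * n - 3"
    using pair_degree_self_pos[of "(x, y)"] xy by auto
  then show ?thesis
    using n_ge card_X_ge_2 by linarith
qed

text \<open>The three kinds of pairs of distinct points get the same degree because
  \<open>2 * n - 3 = card X - 1\<close>. The equation for \<open>l\<close> stays free of division,
  so that everything here is about natural numbers.\<close>

lemma is_design_2:
  assumes "card X = 2 * n - 2"
  shows "\<exists>l. (card X - 1) * l * (fact (card X - n))\<^sup>2 = (fact (card X - 1))\<^sup>2 \<and>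
    is_design 2 ((card X)\<^sup>2) (2 * n) l design"
proof -
  obtain x x' y y' where xy: "x \<in> X" "x' \<in> X" "x \<noteq> x'" "y \<in> Y" "y' \<in> Y" "y \<noteq> y'"
    by (rule ex_points)
  define l where "l = pair_degree (x, y) (x, y')"
  have l: "(card X - 1) * l = pair_degree (x, y) (x, y)"
    using pair_degree_row xy by (simp add: l_def)
  have pos: "card X - 1 > 0" "2 * n - 3 = card X - 1"
    using card_X_ge_2 assms n_ge by auto
  have pair_degree: "pair_degree p q = l" if pq_mem: "p \<noteq> q" "p \<in> X \<times> Y" "q \<in> X \<times> Y" for p q
  proof -
    obtain u v u' v' where pq: "p = (u, v)" "q = (u', v')" by fastforce
    have mem: "u \<in> X" "u' \<in> X" "v \<in> Y" "v' \<in> Y" using pq_mem pq by auto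
    have self: "pair_degree (u, v) (u, v) = (card X - 1) * l"
      unfolding l using mem xy by (intro pair_degree_eq) auto
    consider "u = u'" "v \<noteq> v'" | "u \<noteq> u'" "v = v'" | "u \<noteq> u'" "v \<noteq> v'"
      using pq_mem(1) pq by auto
    then have "(card X - 1) * pair_degree p q = (card X - 1) * l"
    proof cases
      case 1
      then show ?thesis using pair_degree_row[of u v v'] mem self pq by simp
    next
      case 2
      then show ?thesis using pair_degree_col[of u v u'] mem self pq by simp
    next
      case 3
      then show ?thesis using pair_degree_disjoint[of u v u' v'] mem self pq pos
        by (simp add: power2_eq_square)
    qed
    with pos(1) show ?thesis by simp
  qed
  have "card {B \<in> cycles n X Y. T \<subseteq> B} = l" if T: "T \<subseteq> X \<times> Y" "card T = 2" for T
  proof -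
    obtain p q where "T = {p, q}" "p \<noteq> q" using T(2) by (auto simp: card_2_iff)
    then show ?thesis
      using pair_degree[of p q] T(1) by (simp add: pair_degree_def)
  qed
  moreover have "l > 0"
    using l pair_degree_self_pos[of "(x, y)"] xy by (cases l) auto
  ultimately show ?thesis
    using l pair_degree_self_fact[of "(x, y)"] xy by (auto simp: is_design_iff intro!: exI[of _ l])
qed

end

section \<open>The groups acting on the vertices\<close>

text \<open>Serves two groups at once: the family of both parts gives the permutations preserving
  the bipartition, and the family consisting of the first part alone gives \<open>K\<close>.\<close>

lemma subgroup_stabilizing_family:
  assumes "\<F> \<subseteq> Pow V"
  shows "subgroup {g \<in> Bij V. (`) g ` \<F> = \<F>} (BijGroup V)"
proof
  show "{g \<in> Bij V. (`) g ` \<F> = \<F>} \<subseteq> carrier (BijGroup V)"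
    by (auto simp: BijGroup_def)
  have one: "(`) (\<lambda>x\<in>V. x) ` \<F> = \<F>"
  proof -
    have "(`) (\<lambda>x\<in>V. x) ` \<F> = id ` \<F>"
      using assms by (intro image_cong) auto
    then show ?thesis by simp
  qed
  then show "\<one>\<^bsub>BijGroup V\<^esub> \<in> {g \<in> Bij V. (`) g ` \<F> = \<F>}"
    by (simp add: BijGroup_def id_Bij)
  fix g assume g: "g \<in> {g \<in> Bij V. (`) g ` \<F> = \<F>}"
  {
    fix h assume h: "h \<in> {g \<in> Bij V. (`) g ` \<F> = \<F>}"
    have "(`) (compose V g h) ` \<F> = (\<lambda>S. g ` (h ` S)) ` \<F>"
    proof (rule image_cong[OF refl])
      fix S assume "S \<in> \<F>"
      then show "compose V g h ` S = g ` (h ` S)"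
        unfolding image_image using assms by (intro image_cong) (auto simp: compose_def)
    qed
    also have "\<dots> = (`) g ` (`) h ` \<F>"
      by (simp only: image_image)
    finally show "g \<otimes>\<^bsub>BijGroup V\<^esub> h \<in> {g \<in> Bij V. (`) g ` \<F> = \<F>}"
      using g h by (simp add: BijGroup_def compose_Bij)
  }
  have inj: "inj_on g V"
    using g by (simp add: Bij_def bij_betw_def)
  \<comment> \<open>Writing the family as its own image under \<open>g\<close> lets the inverse
    cancel.\<close>
  have "(`) (restrict (inv_into V g) V) ` \<F> = (`) (restrict (inv_into V g) V) ` (`) g ` \<F>"
    using g by simp
  also have "\<dots> = (\<lambda>S. (\<lambda>x\<in>V. x) ` S) ` \<F>"
    unfolding image_image
  proof (intro image_cong refl)
    fix S x assume "S \<in> \<F>" "x \<in> S"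
    then have "x \<in> V" using assms by auto
    moreover have "g x \<in> V"
      using g \<open>x \<in> V\<close> Bij_imp_funcset by auto
    ultimately show "restrict (inv_into V g) V (g x) = (\<lambda>x\<in>V. x) x"
      using inj by simp
  qed
  finally show "inv\<^bsub>BijGroup V\<^esub> g \<in> {g \<in> Bij V. (`) g ` \<F> = \<F>}"
    using g one by (simp add: inv_BijGroup restrict_inv_into_Bij)
qed

text \<open>Residues start at 0 and the enumeration at 1, hence the added 1.\<close>

lemma cyc_seqs_enumeration:
  assumes "inj_on h {1..m}" "0 < n" "n \<le> m"
  shows "(\<lambda>i. h (nat (i mod int n) + 1)) \<in> cyc_seqs n (h ` {1..m})"
proof -
  have mem: "nat (i mod int n) + 1 \<in> {1..m}" for i
  proof -
    have "i mod int n < int n" using assms(2) by simp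
    then have "nat (i mod int n) < m" using assms(2,3) by linarith
    then show ?thesis by simp
  qed
  have "h (nat (i mod int n) + 1) = h (nat (j mod int n) + 1) \<longleftrightarrow> int n dvd i - j" for i j
  proof -
    have "h (nat (i mod int n) + 1) = h (nat (j mod int n) + 1) \<longleftrightarrow>
        nat (i mod int n) = nat (j mod int n)"
      using inj_on_eq_iff[OF assms(1) mem mem] by simp
    also have "\<dots> \<longleftrightarrow> i mod int n = j mod int n"
      using assms(2) by (simp add: eq_nat_nat_iff)
    finally show ?thesis by (simp only: mod_eq_dvd_iff)
  qed
  with mem show ?thesis by (auto simp: cyc_seqs_def)
qed

locale bipartite_graph =
  fixes m :: nat and R C :: "nat \<Rightarrow> 'v"
  assumes bipartition: "bipartition m R C"
begin

abbreviation "X \<equiv> part m R"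
abbreviation "Y \<equiv> part m C"
abbreviation "V \<equiv> vertices m R C"
abbreviation "P \<equiv> pair_points m R C"
abbreviation "act \<equiv> point_action m R C"
abbreviation "edge \<equiv> \<lambda>(x :: 'v, y). {x, y}"

text \<open>An upper bound for \<open>G\<close> with an explicit description: its elements fix both
  parts or exchange them. It spares any analysis of products of generators.\<close>

definition part_perms :: "('v \<Rightarrow> 'v) set" where
  "part_perms = {g \<in> Bij V. (`) g ` {X, Y} = {X, Y}}"

lemma disjoint: "X \<inter> Y = {}"
  using bipartition by (simp add: bipartition_def)

lemma finite_P: "finite P"
  by (simp add: pair_points_def)

lemma image_part_C:
  assumes "bij_betw g V V" "g ` X = X"
  shows "g ` Y = Y"
proof -
  have "Y = V - X" using disjoint by (auto simp: vertices_def)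
  moreover have "g ` (V - X) = g ` V - g ` X"
    using assms(1) by (intro inj_on_image_set_diff[of g V]) (auto simp: bij_betw_def vertices_def)
  ultimately show ?thesis
    using assms by (simp add: bij_betw_def)
qed

text \<open>A permutation of \<open>V\<close> that fixes the first part also fixes its complement,
  so it splits into its two restrictions. The singleton family is chosen to match
  \<open>subgroup_stabilizing_family\<close>.\<close>

lemma carrier_K: "carrier (group_K m R C) = {g \<in> Bij V. (`) g ` {X} = {X}}"
proof (intro equalityI subsetI)
  fix g assume "g \<in> carrier (group_K m R C)"
  then obtain \<sigma> \<rho> where \<sigma>: "\<sigma> \<in> Bij X" and \<rho>: "\<rho> \<in> Bij Y" and g: "g = pair_perm m R C (\<sigma>, \<rho>)"
    by (auto simp: group_K_def DirProd_def BijGroup_def)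
  have gX: "g x = \<sigma> x" if "x \<in> X" for x
    using that by (simp add: g pair_perm_def vertices_def)
  have gY: "g y = \<rho> y" if "y \<in> Y" for y
    using that disjoint by (auto simp: g pair_perm_def vertices_def)
  have "bij_betw g X X" "bij_betw g Y Y"
    using \<sigma> \<rho> gX gY bij_betw_cong[of X g \<sigma>] bij_betw_cong[of Y g \<rho>] by (auto simp: Bij_def)
  moreover from this have "bij_betw g V V"
    unfolding vertices_def using disjoint by (intro bij_betw_combine)
  moreover have "g \<in> extensional V"
    by (simp add: g pair_perm_def)
  ultimately show "g \<in> {g \<in> Bij V. (`) g ` {X} = {X}}"
    by (simp add: Bij_def bij_betw_imp_surj_on)
next
  fix g assume "g \<in> {g \<in> Bij V. (`) g ` {X} = {X}}"
  then have g: "g \<in> extensional V" "bij_betw g V V" "g ` X = X"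
    by (auto simp: Bij_def)
  have "bij_betw g X X"
    using g by (auto simp: bij_betw_def vertices_def intro: inj_on_subset)
  moreover have "bij_betw g Y Y"
    using g image_part_C by (auto simp: bij_betw_def vertices_def intro: inj_on_subset)
  ultimately have "(restrict g X, restrict g Y) \<in> carrier (BijGroup X \<times>\<times> BijGroup Y)"
    by (simp add: BijGroup_def Bij_def)
  moreover have "g = pair_perm m R C (restrict g X, restrict g Y)"
    using g(1) by (auto simp: fun_eq_iff pair_perm_def vertices_def extensional_def)
  ultimately show "g \<in> carrier (group_K m R C)"
    by (auto simp: group_K_def)
qed

lemma K_subset_part_perms: "carrier (group_K m R C) \<subseteq> part_perms"
proof
  fix g assume "g \<in> carrier (group_K m R C)"
  then have g: "g \<in> Bij V" "g ` X = X"
    by (simp_all add: carrier_K)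
  then have "g ` Y = Y"
    using image_part_C by (simp add: Bij_def)
  with g have "(`) g ` {X, Y} = {X, Y}"
    by (simp only: image_insert image_empty)
  with g(1) show "g \<in> part_perms"
    by (simp add: part_perms_def)
qed

lemma subgroup_part_perms: "subgroup part_perms (BijGroup V)"
  unfolding part_perms_def by (rule subgroup_stabilizing_family) (auto simp: vertices_def)

lemma subgroup_K: "subgroup (carrier (group_K m R C)) (BijGroup V)"
  unfolding carrier_K by (rule subgroup_stabilizing_family) (auto simp: vertices_def)

lemma part_perms_cases:
  assumes "g \<in> part_perms"
  obtains "g ` X = X" "g ` Y = Y" | "g ` X = Y" "g ` Y = X"
  using assms by (auto simp: part_perms_def doubleton_eq_iff)

lemma swap_parts_in_part_perms: "swap_parts m R C \<in> part_perms"
proof -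
  let ?s = "swap_parts m R C"
  have inj: "inj_on R {1..m}" "inj_on C {1..m}"
    using bipartition by (auto simp: bipartition_def)
  have sR: "?s (R i) = C i" if "i \<in> {1..m}" for i
    using that inj by (simp add: swap_parts_def vertices_def the_inv_into_f_f)
  have sC: "?s (C i) = R i" if "i \<in> {1..m}" for i
  proof -
    have "C i \<notin> X" using that disjoint by blast
    then show ?thesis
      using that inj by (simp add: swap_parts_def vertices_def the_inv_into_f_f)
  qed
  have X: "?s ` X = Y" unfolding image_image using sR by (intro image_cong) auto
  have Y: "?s ` Y = X" unfolding image_image using sC by (intro image_cong) auto
  \<comment> \<open>The swap is an involution and so serves as its own inverse below.\<close>
  have "?s (?s x) = x" if "x \<in> V" for x
    using that sR sC unfolding vertices_def by (elim UnE imageE) metis+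
  moreover have "?s ` V = V"
    using X Y by (auto simp: vertices_def image_Un)
  ultimately have "bij_betw ?s V V"
    by (intro bij_betw_byWitness[where f' = ?s]) auto
  then have "?s \<in> Bij V"
    by (simp add: Bij_def) (simp add: swap_parts_def)
  then show ?thesis
    using X Y by (auto simp: part_perms_def)
qed

text \<open>All that is used about \<open>G\<close>: it is a subgroup between \<open>K\<close>,
  which is large enough for transitivity, and \<open>part_perms\<close>, which is small enough to
  preserve the set of cycles.\<close>

lemma G_bounds:
  shows subgroup_G: "subgroup (carrier (group_G m R C)) (BijGroup V)"
    and G_subset_part_perms: "carrier (group_G m R C) \<subseteq> part_perms"
    and K_subset_G: "carrier (group_K m R C) \<subseteq> carrier (group_G m R C)"
proof -
  interpret B: group "BijGroup V" by (rule group_BijGroup)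
  have sub: "insert (swap_parts m R C) (carrier (group_K m R C)) \<subseteq> part_perms"
    using swap_parts_in_part_perms K_subset_part_perms by simp
  have G: "carrier (group_G m R C) =
      generate (BijGroup V) (insert (swap_parts m R C) (carrier (group_K m R C)))"
    by (simp add: group_G_def)
  show "subgroup (carrier (group_G m R C)) (BijGroup V)"
    unfolding G using sub subgroup.subset[OF subgroup_part_perms] by (intro B.generate_is_subgroup) blast
  show "carrier (group_G m R C) \<subseteq> part_perms"
    unfolding G by (rule B.generate_subgroup_incl[OF sub subgroup_part_perms])
  show "carrier (group_K m R C) \<subseteq> carrier (group_G m R C)"
    unfolding G by (auto intro: generate.incl)
qed

section \<open>The action on points and its transitivity on flags\<close>

lemma edge_inj: "inj_on edge P"
  using disjoint by (auto simp: inj_on_def pair_points_def doubleton_eq_iff)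

lemma block_of_edge_set:
  assumes "S \<subseteq> P"
  shows "block_of m R C (edge ` S) = S"
proof -
  have "(x, y) \<in> block_of m R C (edge ` S) \<longleftrightarrow> (x, y) \<in> S" for x y
    using inj_on_image_mem_iff[OF edge_inj _ assms, of "(x, y)"] assms
    by (auto simp: block_of_def simp del: insert_iff)
  then show ?thesis by auto
qed

text \<open>With \<open>edge_inj\<close> this pins down \<open>act g p\<close> as the only point
  whose edge is the image of the edge of \<open>p\<close>; injectivity and the composition law are
  deduced by comparing edges.\<close>

lemma act_edge:
  assumes "g \<in> part_perms" "p \<in> P"
  shows "act g p \<in> P" "edge (act g p) = g ` edge p"
proof -
  obtain x y where p: "p = (x, y)" "x \<in> X" "y \<in> Y"
    using assms(2) by (auto simp: pair_points_def)
  have "act g p \<in> P \<and> edge (act g p) = g ` edge p"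
    using assms(1)
  proof (cases rule: part_perms_cases)
    case 1
    then have "g x \<in> X" "g y \<in> Y" using p by auto
    then show ?thesis
      using p assms(2) by (simp add: point_action_def) (simp add: pair_points_def)
  next
    case 2
    then have "g x \<in> Y" "g y \<in> X" using p by auto
    moreover from this have "g x \<notin> X" using disjoint by auto
    ultimately show ?thesis
      using p assms(2) by (simp add: point_action_def insert_commute) (simp add: pair_points_def)
  qed
  then show "act g p \<in> P" "edge (act g p) = g ` edge p" by auto
qed

lemma act_Bij:
  assumes "g \<in> part_perms"
  shows "act g \<in> Bij P"
proof -
  have "inj_on g V"
    using assms by (simp add: part_perms_def Bij_def bij_betw_def)
  have "inj_on (act g) P"
  proof (rule inj_onI)
    fix p q assume pq: "p \<in> P" "q \<in> P" "act g p = act g q"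
    then have "g ` edge p = g ` edge q"
      using act_edge(2)[OF assms] by metis
    moreover have "edge p \<subseteq> V" "edge q \<subseteq> V"
      using pq by (auto simp: pair_points_def vertices_def)
    ultimately have "edge p = edge q"
      using inj_on_image_eq_iff[OF \<open>inj_on g V\<close>] by simp
    then show "p = q"
      using inj_onD[OF edge_inj] pq(1,2) by simp
  qed
  moreover have "act g ` P \<subseteq> P"
    using act_edge(1)[OF assms] by auto
  ultimately have "bij_betw (act g) P P"
    using finite_P by (simp add: bij_betw_def endo_inj_surj)
  then show ?thesis
    by (simp add: Bij_def point_action_def)
qed

lemma act_compose:
  assumes "g \<in> part_perms" "h \<in> part_perms"
  shows "act (compose V g h) = compose P (act g) (act h)"
proof
  fix p
  have gh: "compose V g h \<in> part_perms"
    using subgroup.m_closed[OF subgroup_part_perms assms] assms by (simp add: BijGroup_def part_perms_def)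
  show "act (compose V g h) p = compose P (act g) (act h) p"
  proof (cases "p \<in> P")
    case True
    then have "edge p \<subseteq> V" by (auto simp: pair_points_def vertices_def)
    then have "compose V g h ` edge p = g ` h ` edge p"
      unfolding image_image by (intro image_cong) (auto simp: compose_def)
    then have "edge (act (compose V g h) p) = edge (act g (act h p))"
      using act_edge[OF gh True] act_edge[OF assms(2) True]
        act_edge(2)[OF assms(1) act_edge(1)[OF assms(2) True]] by simp
    then have "act (compose V g h) p = act g (act h p)"
      using inj_onD[OF edge_inj] act_edge(1)[OF gh True]
        act_edge(1)[OF assms(1) act_edge(1)[OF assms(2) True]] by blast
    with True show ?thesis by (simp add: compose_def)
  qed (simp add: point_action_def compose_def)
qed

lemma group_action_act:
  assumes "subgroup L (BijGroup V)" "L \<subseteq> part_perms"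
  shows "group_action ((BijGroup V)\<lparr>carrier := L\<rparr>) P act"
  unfolding group_action_def group_hom_def group_hom_axioms_def
proof (intro conjI)
  show "group ((BijGroup V)\<lparr>carrier := L\<rparr>)"
    by (rule subgroup.subgroup_is_group[OF assms(1) group_BijGroup])
  show "group (BijGroup P)" by (rule group_BijGroup)
  have "L \<subseteq> Bij V" using assms(2) by (auto simp: part_perms_def)
  then show "act \<in> hom ((BijGroup V)\<lparr>carrier := L\<rparr>) (BijGroup P)"
    using assms(2) act_Bij act_compose by (auto simp: hom_def BijGroup_def subset_iff)
qed

text \<open>Translates images of graphs into images of point sets, so that blocks can be treated as
  sets of the form \<open>cyc f g\<close>.\<close>

lemma block_of_graph_image:
  assumes "g \<in> part_perms" "S \<subseteq> P"
  shows "block_of m R C (graph_image g (edge ` S)) = act g ` S"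
proof -
  have "graph_image g (edge ` S) = edge ` act g ` S"
    unfolding graph_image_def image_image
    using act_edge(2)[OF assms(1)] assms(2) by (intro image_cong refl) (metis subsetD)
  moreover have "act g ` S \<subseteq> P"
    using act_edge(1)[OF assms(1)] assms(2) by auto
  ultimately show ?thesis
    using block_of_edge_set by metis
qed

text \<open>If \<open>g\<close> fixes the parts, it acts coordinatewise; if it exchanges them, the
  coordinates are swapped first. Both operations turn cycles into cycles.\<close>

lemma act_cycles:
  assumes "g \<in> part_perms" "B \<in> cycles n X Y"
  shows "act g ` B \<in> cycles n X Y"
proof -
  have BP: "B \<subseteq> X \<times> Y" using cycles_subset[OF assms(2)] .
  have "inj_on g V"
    using assms(1) by (simp add: part_perms_def Bij_def bij_betw_def)
  then have inj: "inj_on g X" "inj_on g Y"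
    by (auto simp: vertices_def intro: inj_on_subset)
  show ?thesis
    using assms(1)
  proof (cases rule: part_perms_cases)
    case 1
    have "act g p = map_prod g g p" if "p \<in> B" for p
    proof -
      obtain x y where "p = (x, y)" "x \<in> X" "y \<in> Y" using \<open>p \<in> B\<close> BP by blast
      moreover have "g x \<in> X" using 1(1) \<open>x \<in> X\<close> by blast
      ultimately show ?thesis by (simp add: point_action_def pair_points_def)
    qed
    then have "act g ` B = map_prod g g ` B"
      by (intro image_cong) auto
    moreover have "bij_betw g X X" "bij_betw g Y Y"
      using 1 inj by (auto simp: bij_betw_def)
    ultimately show ?thesis
      using cycles_image assms(2) by metis
  next
    case 2
    have "act g p = map_prod g g (prod.swap p)" if "p \<in> B" for p
    proof -
      obtain x y where "p = (x, y)" "x \<in> X" "y \<in> Y" using \<open>p \<in> B\<close> BP by blast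
      moreover have "g x \<notin> X" using 2(1) \<open>x \<in> X\<close> disjoint by blast
      ultimately show ?thesis by (simp add: point_action_def pair_points_def)
    qed
    then have "act g ` B = map_prod g g ` prod.swap ` B"
      unfolding image_image by (intro image_cong) auto
    moreover have "bij_betw g X Y" "bij_betw g Y X"
      using 2 inj by (auto simp: bij_betw_def)
    ultimately show ?thesis
      using cycles_image cycles_swap[OF assms(2)] by metis
  qed
qed

lemma ex_K:
  assumes "bij_betw \<sigma> X X" "bij_betw \<rho> Y Y"
  shows "\<exists>g \<in> carrier (group_K m R C). \<forall>p \<in> P. act g p = map_prod \<sigma> \<rho> p"
proof
  let ?g = "pair_perm m R C (restrict \<sigma> X, restrict \<rho> Y)"
  show "?g \<in> carrier (group_K m R C)"
    using assms by (auto simp: group_K_def BijGroup_def Bij_def)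
  show "\<forall>p \<in> P. act ?g p = map_prod \<sigma> \<rho> p"
  proof
    fix p assume "p \<in> P"
    then obtain x y where p: "p = (x, y)" "x \<in> X" "y \<in> Y" "y \<notin> X"
      using disjoint by (auto simp: pair_points_def)
    then have "\<sigma> x \<in> X" "?g x = \<sigma> x" "?g y = \<rho> y"
      using assms by (auto simp: pair_perm_def vertices_def bij_betw_def)
    then show "act ?g p = map_prod \<sigma> \<rho> p"
      using p by (simp add: point_action_def pair_points_def)
  qed
qed

text \<open>Both cycles are labelled from their prescribed edges. The permutations of the two parts
  that match the labels come from one element of \<open>K\<close>, which then carries the first flag
  to the second.\<close>

lemma K_flag_transitive_on_cycles:
  assumes "B \<in> cycles n X Y" "p \<in> B" "B' \<in> cycles n X Y" "p' \<in> B'"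
  shows "\<exists>g \<in> carrier (group_K m R C). act g p = p' \<and> act g ` B = B'"
proof -
  obtain f g where fg: "f \<in> cyc_seqs n X" "g \<in> cyc_seqs n Y" "B = cyc f g" "p = (f 0, g 0)"
    using cycles_based_at[OF assms(1,2)] by auto
  obtain f' g' where fg': "f' \<in> cyc_seqs n X" "g' \<in> cyc_seqs n Y" "B' = cyc f' g'" "p' = (f' 0, g' 0)"
    using cycles_based_at[OF assms(3,4)] by auto
  obtain \<sigma> where \<sigma>: "bij_betw \<sigma> X X" "\<sigma> \<circ> f = f'"
    using cyc_seqs_transitive[OF _ fg(1) fg'(1)] by auto
  obtain \<rho> where \<rho>: "bij_betw \<rho> Y Y" "\<rho> \<circ> g = g'"
    using cyc_seqs_transitive[OF _ fg(2) fg'(2)] by auto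
  obtain k where k: "k \<in> carrier (group_K m R C)" "\<forall>p \<in> P. act k p = map_prod \<sigma> \<rho> p"
    using ex_K[OF \<sigma>(1) \<rho>(1)] by blast
  have BP: "B \<subseteq> P"
    using cycles_subset[OF assms(1)] by (simp add: pair_points_def)
  then have "act k ` B = map_prod \<sigma> \<rho> ` B"
    using k(2) by (intro image_cong) auto
  then have "act k ` B = B'"
    using fg(3) fg'(3) \<sigma>(2) \<rho>(2) by (simp add: cyc_image)
  moreover have "act k p = p'"
    using BP assms(2) k(2) fg(4) fg'(4) \<sigma>(2) \<rho>(2) by auto
  ultimately show ?thesis using k(1) by blast
qed

lemma flag_transitive_cycles:
  assumes "subgroup L (BijGroup V)" "L \<subseteq> part_perms" "carrier (group_K m R C) \<subseteq> L"
  shows "flag_transitive ((BijGroup V)\<lparr>carrier := L\<rparr>) act (P, cycles n X Y)"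
  unfolding flag_transitive_def
proof (intro conjI)
  show "group_action ((BijGroup V)\<lparr>carrier := L\<rparr>) (fst (P, cycles n X Y)) act"
    using group_action_act[OF assms(1,2)] by simp
  show "act ` carrier ((BijGroup V)\<lparr>carrier := L\<rparr>) \<subseteq> automorphisms (P, cycles n X Y)"
  proof (rule image_subsetI)
    fix g assume "g \<in> carrier ((BijGroup V)\<lparr>carrier := L\<rparr>)"
    then have g: "g \<in> part_perms" using assms(2) by auto
    have "cycles n X Y \<subseteq> Pow P"
      unfolding pair_points_def using cycles_subset by blast
    moreover have "inj_on (act g) P"
      using act_Bij[OF g] by (simp add: Bij_def bij_betw_def)
    ultimately have "inj_on ((`) (act g)) (cycles n X Y)"
      by (meson inj_on_image_Pow inj_on_subset)
    moreover have "(`) (act g) ` cycles n X Y \<subseteq> cycles n X Y"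
      using act_cycles[OF g] by auto
    \<comment> \<open>An injective map of a finite set into itself is onto.\<close>
    ultimately have "(`) (act g) ` cycles n X Y = cycles n X Y"
      by (intro endo_inj_surj finite_cycles) auto
    then show "act g \<in> automorphisms (P, cycles n X Y)"
      using act_Bij[OF g] by (simp add: automorphisms_def)
  qed
  show "\<forall>(p, B) \<in> flags (P, cycles n X Y). \<forall>(q, B') \<in> flags (P, cycles n X Y).
      \<exists>g \<in> carrier ((BijGroup V)\<lparr>carrier := L\<rparr>). act g p = q \<and> act g ` B = B'"
  proof (intro ballI case_prodI2)
    fix s p B s' q B'
    assume "s \<in> flags (P, cycles n X Y)" "s = (p, B)" "s' \<in> flags (P, cycles n X Y)" "s' = (q, B')"
    then have "B \<in> cycles n X Y" "p \<in> B" "B' \<in> cycles n X Y" "q \<in> B'"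
      by (simp_all add: flags_def)
    then obtain g where "g \<in> carrier (group_K m R C)" "act g p = q \<and> act g ` B = B'"
      using K_flag_transitive_on_cycles by blast
    with assms(3) show "\<exists>g \<in> carrier ((BijGroup V)\<lparr>carrier := L\<rparr>). act g p = q \<and> act g ` B = B'"
      by auto
  qed
qed

section \<open>The given cycle and its orbits\<close>

lemma cycle_graph_eq:
  assumes "a > 0"
  shows "cycle_graph a R C =
    edge ` cyc (\<lambda>i. R (nat (i mod int a) + 1)) (\<lambda>i. C (nat (i mod int a) + 1))"
    (is "_ = edge ` cyc ?f ?g")
proof
  show "cycle_graph a R C \<subseteq> edge ` cyc ?f ?g"
  proof
    fix e assume "e \<in> cycle_graph a R C"
    then consider i where "e = {R i, C i}" "1 \<le> i" "i \<le> a"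
      | i where "e = {R (i + 1), C i}" "1 \<le> i" "i \<le> a - 1" | "e = {R 1, C a}"
      by (auto simp: cycle_graph_def)
    then show "e \<in> edge ` cyc ?f ?g"
    proof cases
      case 1
      then have "(int i - 1) mod int a = int i - 1" "Suc (nat (int i - 1)) = i" by auto
      with 1 have "e = edge (?f (int i - 1), ?g (int i - 1))" by simp
      then show ?thesis unfolding cyc_def by blast
    next
      case 2
      then have "(int i - 1) mod int a = int i - 1" "int i mod int a = int i" "Suc (nat (int i - 1)) = i" by auto
      with 2 have "e = edge (?f (int i - 1 + 1), ?g (int i - 1))" by simp
      then show ?thesis unfolding cyc_def by blast
    next
      case 3
      \<comment> \<open>The closing edge comes from index \<open>a - 1\<close>: there
        \<open>i + 1\<close> wraps around to residue 0, which is labelled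
        \<open>R 1\<close>.\<close>
      have "(int a - 1) mod int a = int a - 1" "int a mod int a = 0" "Suc (nat (int a - 1)) = a"
        using assms by (auto simp: zmod_minus1)
      with 3 assms have "e = edge (?f (int a - 1 + 1), ?g (int a - 1))" by simp
      then show ?thesis unfolding cyc_def by blast
    qed
  qed
  show "edge ` cyc ?f ?g \<subseteq> cycle_graph a R C"
  proof
    fix e assume "e \<in> edge ` cyc ?f ?g"
    then consider i where "e = {?f i, ?g i}" | i where "e = {?f (i + 1), ?g i}"
      unfolding cyc_def by auto
    then show "e \<in> cycle_graph a R C"
    proof cases
      case 1
      define j where "j = nat (i mod int a) + 1"
      have "1 \<le> j" "j \<le> a"
        using assms by (simp_all add: j_def Suc_le_eq nat_less_iff)
      with 1 show ?thesis unfolding cycle_graph_def j_def[symmetric] by blast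
    next
      case 2
      define j where "j = nat (i mod int a) + 1"
      have j: "1 \<le> j" "j \<le> a"
        using assms by (simp_all add: j_def Suc_le_eq nat_less_iff)
      have ij: "i mod int a = int j - 1" "Suc (nat (int j - 1)) = j"
        using assms by (simp_all add: j_def)
      have "(i + 1) mod int a = (i mod int a + 1) mod int a"
        by (simp add: mod_simps)
      also have "\<dots> = int j mod int a"
        by (simp add: ij)
      finally have i1: "(i + 1) mod int a = int j mod int a" .
      show ?thesis
      proof (cases "j = a")
        case True
        with 2 ij have "e = {R 1, C a}" by (simp add: i1)
        then show ?thesis by (simp add: cycle_graph_def)
      next
        case False
        with 2 j have "e = {R (j + 1), C j}" by (simp add: i1 ij)
        moreover have "j \<le> a - 1" using j False by simp
        ultimately show ?thesis using j unfolding cycle_graph_def by blast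
      qed
    qed
  qed
qed

text \<open>Images of the given cycle under \<open>part_perms\<close> are cycles, and
  \<open>K\<close> already reaches every cycle. Any set of permutations between the two therefore
  yields the same blocks.\<close>

lemma designs_eq_cycles:
  assumes "2 \<le> a" "a \<le> m"
  shows "design_K m R C (cycle_graph a R C) = (P, cycles a X Y)"
    and "design_G m R C (cycle_graph a R C) = (P, cycles a X Y)"
proof -
  let ?f = "\<lambda>i. R (nat (i mod int a) + 1)" and ?g = "\<lambda>i. C (nat (i mod int a) + 1)"
  let ?B = "cyc ?f ?g"
  have B: "?B \<in> cycles a X Y"
    using cyc_seqs_enumeration[of R m a] cyc_seqs_enumeration[of C m a] assms bipartition
    unfolding cycles_def bipartition_def by auto
  have p: "(?f 0, ?g 0) \<in> ?B" unfolding cyc_def by blast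
  have BP: "?B \<subseteq> P" using cycles_subset[OF B] by (simp add: pair_points_def)
  have eq: "{block_of m R C (graph_image g (cycle_graph a R C)) | g. g \<in> L} = cycles a X Y"
    if L: "carrier (group_K m R C) \<subseteq> L" "L \<subseteq> part_perms" for L
  proof -
    have "{block_of m R C (graph_image g (cycle_graph a R C)) | g. g \<in> L} = (\<lambda>g. act g ` ?B) ` L"
      using block_of_graph_image[OF _ BP] L(2) assms(1) by (auto simp: cycle_graph_eq)
    also have "\<dots> = cycles a X Y"
    proof
      show "(\<lambda>g. act g ` ?B) ` L \<subseteq> cycles a X Y"
        using act_cycles[OF _ B] L(2) by auto
      show "cycles a X Y \<subseteq> (\<lambda>g. act g ` ?B) ` L"
      proof
        fix B' assume B': "B' \<in> cycles a X Y"
        then obtain q where "q \<in> B'" by (auto simp: cycles_def cyc_def)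
        then show "B' \<in> (\<lambda>g. act g ` ?B) ` L"
          using K_flag_transitive_on_cycles[OF B p B'] L(1) by blast
      qed
    qed
    finally show ?thesis .
  qed
  show "design_K m R C (cycle_graph a R C) = (P, cycles a X Y)"
    unfolding design_K_def using eq[OF _ K_subset_part_perms] by simp
  show "design_G m R C (cycle_graph a R C) = (P, cycles a X Y)"
    unfolding design_G_def using eq[OF K_subset_G G_subset_part_perms] by simp
qed

end

theorem lemma4p5:
  fixes k a m :: nat
    and R C :: "nat \<Rightarrow> 'v"
    and \<Delta> :: "'v set set"
    and D :: "('v \<times> 'v) incidence_structure"
  assumes "bipartition m R C"
    and "k = 2 * a" and "k \<ge> 4"
    and "real k \<le> (real m)^2 / 2" and "m \<ge> a"
    and "\<Delta> = cycle_graph a R C"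
    and "D = design_K m R C \<Delta>"
  shows "design_K m R C \<Delta> = design_G m R C \<Delta> \<and>
    is_t_design 1 D \<and>
    flag_transitive (group_K m R C) (point_action m R C) D \<and>
    flag_transitive (group_G m R C) (point_action m R C) D \<and>
    \<not> is_t_design 3 D \<and>
    (is_t_design 2 D \<longleftrightarrow> m = k - 2) \<and>
    (m = k - 2 \<longrightarrow>
      (\<exists>l::nat. real l = (fact (k - 3) * fact (k - 4)) / (fact (k div 2 - 2))^2 \<and>
                is_design 2 ((k - 2)^2) k l D))"
proof -
  interpret bipartite_graph m R C
    using assms(1) by unfold_locales
  have a: "2 \<le> a" "a \<le> m" using assms by auto
  \<comment> \<open>For \<open>m \<le> 2\<close> the bound gives \<open>k \<le> 2\<close>, against
    \<open>k \<ge> 4\<close>. A row thus has three points, as the failure of the 3-design property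
    requires.\<close>
  have m: "m \<ge> 3"
  proof (rule ccontr)
    assume "\<not> m \<ge> 3"
    then have "(real m)\<^sup>2 \<le> 2\<^sup>2" by (intro power_mono) auto
    with assms(3,4) show False by simp
  qed
  have D: "D = (P, cycles a X Y)" "design_K m R C \<Delta> = design_G m R C \<Delta>"
    using designs_eq_cycles[OF a] assms(6,7) by auto
  have card: "card X = m" "card Y = m"
    using assms(1) by (auto simp: bipartition_def card_image)
  interpret cycle_design a X Y
    using a card by unfold_locales auto
  have D': "D = (X \<times> Y, cycles a X Y)"
    by (simp add: D pair_points_def)
  have K: "group_K m R C = (BijGroup V)\<lparr>carrier := carrier (group_K m R C)\<rparr>"
    by (simp add: group_K_def)
  have G: "group_G m R C = (BijGroup V)\<lparr>carrier := carrier (group_G m R C)\<rparr>"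
    by (simp add: group_G_def)
  have design_2: "\<exists>l::nat. real l = (fact (k - 3) * fact (k - 4)) / (fact (k div 2 - 2))^2 \<and>
      is_design 2 ((k - 2)^2) k l D" if mk: "m = k - 2"
  proof -
    obtain l where l: "(m - 1) * l * (fact (m - a))\<^sup>2 = (fact (m - 1))\<^sup>2"
      and design: "is_design 2 (m\<^sup>2) k l D"
      using is_design_2 mk card assms(2) by (auto simp: D')
    have idx: "m - a = k div 2 - 2" "m - 1 = k - 3" "k - 3 > 0" "k - 3 - 1 = k - 4"
      using mk m assms(2) by auto
    \<comment> \<open>One factor \<open>fact (k - 3)\<close> of the square is split as
      \<open>(k - 3) * fact (k - 4)\<close>, so that \<open>m - 1 = k - 3\<close> cancels.\<close>
    have "(k - 3) * (l * (fact (k div 2 - 2))\<^sup>2) = (k - 3) * (fact (k - 3) * fact (k - 4))"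
      using l idx fact_reduce[of "k - 3", where 'a = nat]
      by (simp add: power2_eq_square mult.assoc mult.left_commute)
    then have "l * (fact (k div 2 - 2))\<^sup>2 = fact (k - 3) * fact (k - 4)"
      using idx(3) by simp
    then have "real (l * (fact (k div 2 - 2))\<^sup>2) = real (fact (k - 3) * fact (k - 4))"
      by (simp only:)
    then have "real l * (fact (k div 2 - 2))\<^sup>2 = fact (k - 3) * fact (k - 4)"
      by simp
    then have "real l = (fact (k - 3) * fact (k - 4)) / (fact (k div 2 - 2))^2"
      by (simp add: eq_divide_eq)
    with design mk show ?thesis by auto
  qed
  show ?thesis
  proof (intro conjI)
    show "design_K m R C \<Delta> = design_G m R C \<Delta>" by (rule D)
    show "is_t_design 1 D"
      using is_design_1 by (auto simp: D' is_t_design_def)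
    show "flag_transitive (group_K m R C) act D"
      unfolding D(1) using flag_transitive_cycles[OF subgroup_K K_subset_part_perms order_refl] K by metis
    show "flag_transitive (group_G m R C) act D"
      unfolding D(1) using flag_transitive_cycles[OF subgroup_G G_subset_part_perms K_subset_G] G by metis
    show "\<not> is_t_design 3 D"
      using not_is_design_3 m card by (auto simp: D' is_t_design_def)
    show "is_t_design 2 D \<longleftrightarrow> m = k - 2"
      using is_design_2_imp design_2 card assms(2) unfolding is_t_design_def D' by metis
    show "m = k - 2 \<longrightarrow>
      (\<exists>l::nat. real l = (fact (k - 3) * fact (k - 4)) / (fact (k div 2 - 2))^2 \<and>
                is_design 2 ((k - 2)^2) k l D)"
      using design_2 by blast
  qed
qed

end
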